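(* Let $X\subset\mathbb{R}^n$ be a finite set and $f\colon X\to\{-1,1\}$, $F\colon\{-1,1\}^k\to\{-1,1\}$ given functions. Then for each $\epsilon,\delta>0$, \[\deg_{\epsilon+\eta-2+2(1-\delta)^{C(F)}}(F(f,\dots,f))\geq\deg_\epsilon(F)\,\deg_{1-\delta}(f)\] for some $\eta=\eta(\epsilon,F)>0$.
   Context: For $h\colon Z\to\{-1,1\}$ on a finite $Z\subset\mathbb{R}^m$, $\deg_\epsilon(h)$ is the least total degree of a real polynomial $p$ with $|h(z)-p(z)|\leq\epsilon$ for all $z\in Z$. $F(f,\dots,f)$ is $(x_1,\dots,x_k)\mapsto F(f(x_1),\dots,f(x_k))$ on $X^k$. Certificate complexity: for $x\in\{-1,1\}^k$, $C_x(F)$ is the minimum size of a set $S\subseteq\{1,\dots,k\}$ such that $F(x)=F(y)$ for all $y\in\{-1,1\}^k$ agreeing with $x$ on $S$; $C(F)=\max_xC_x(F)$.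
   Formalization: The formal statement assumes 0 < δ ≤ 1: for δ > 1 the error 1−δ is negative, so deg_{1−δ}(f) is undefined on nonempty X (and reading it as ∞ makes the claim false, e.g. δ = 3, C(F) = 2); a degree with no qualifying polynomial is read as ∞. *)

theory Defs
  imports Complex_Main "HOL-Library.Poly_Mapping" "HOL-Library.FuncSet" "HOL-Library.Extended_Nat"
begin

text \<open>A point of Euclidean space with coordinates indexed by \<open>I\<close> is an element of
  \<open>I \<rightarrow>\<^sub>E UNIV\<close>; in particular n-space is \<open>{..<n} \<rightarrow>\<^sub>E UNIV\<close>.
  Real polynomials in variables of type \<open>'v\<close> are finitely supported maps from
  monomials (finitely supported exponent functions) to coefficients.\<close>

type_synonym 'v rpoly = "('v \<Rightarrow>\<^sub>0 nat) \<Rightarrow>\<^sub>0 real"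

definition rpoly_vars :: "'v rpoly \<Rightarrow> 'v set" where
  "rpoly_vars p = (\<Union>m \<in> Poly_Mapping.keys p. Poly_Mapping.keys m)"

definition rpoly_eval :: "'v rpoly \<Rightarrow> ('v \<Rightarrow> real) \<Rightarrow> real" where
  "rpoly_eval p z =
     (\<Sum>m \<in> Poly_Mapping.keys p. Poly_Mapping.lookup p m *
        (\<Prod>v \<in> Poly_Mapping.keys m. z v ^ Poly_Mapping.lookup m v))"

text \<open>The zero polynomial has total degree 0.\<close>

definition total_degree :: "'v rpoly \<Rightarrow> nat" where
  "total_degree p =
     Max (insert 0 ((\<lambda>m. \<Sum>v \<in> Poly_Mapping.keys m. Poly_Mapping.lookup m v) ` Poly_Mapping.keys p))"

text \<open>The \<open>e\<close>-approximate degree of \<open>h\<close> on \<open>Z \<subseteq> (I \<rightarrow>\<^sub>E UNIV)\<close>.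
  It is \<open>\<infinity>\<close> if no approximating polynomial exists (\<open>e < 0\<close> and \<open>Z\<close> nonempty).\<close>

definition approx_deg :: "'v set \<Rightarrow> ('v \<Rightarrow> real) set \<Rightarrow> real \<Rightarrow> (('v \<Rightarrow> real) \<Rightarrow> real) \<Rightarrow> enat" where
  "approx_deg I Z e h =
     (INF p \<in> {p. rpoly_vars p \<subseteq> I \<and> (\<forall>z\<in>Z. \<bar>h z - rpoly_eval p z\<bar> \<le> e)}. enat (total_degree p))"

definition sign_cube :: "nat \<Rightarrow> (nat \<Rightarrow> real) set" where
  "sign_cube k = {..<k} \<rightarrow>\<^sub>E {-1, 1}"

definition cert_complexity_at :: "nat \<Rightarrow> ((nat \<Rightarrow> real) \<Rightarrow> real) \<Rightarrow> (nat \<Rightarrow> real) \<Rightarrow> nat" where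
  "cert_complexity_at k F x =
     Min (card ` {S. S \<subseteq> {..<k} \<and>
       (\<forall>y \<in> sign_cube k. (\<forall>i\<in>S. y i = x i) \<longrightarrow> F x = F y)})"

definition cert_complexity :: "nat \<Rightarrow> ((nat \<Rightarrow> real) \<Rightarrow> real) \<Rightarrow> nat" where
  "cert_complexity k F = Max (cert_complexity_at k F ` sign_cube k)"

text \<open>A point of the \<open>k\<close>-fold product of n-space is a single vector with coordinates
  indexed by \<open>{..<k} \<times> {..<n}\<close>; \<open>block n z i\<close> is its \<open>i\<close>-th component.\<close>

definition block :: "nat \<Rightarrow> (nat \<times> nat \<Rightarrow> real) \<Rightarrow> nat \<Rightarrow> (nat \<Rightarrow> real)" where
  "block n z i = (\<lambda>j\<in>{..<n}. z (i, j))"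

definition set_power :: "nat \<Rightarrow> nat \<Rightarrow> (nat \<Rightarrow> real) set \<Rightarrow> (nat \<times> nat \<Rightarrow> real) set" where
  "set_power n k X = {z \<in> ({..<k} \<times> {..<n}) \<rightarrow>\<^sub>E UNIV. \<forall>i<k. block n z i \<in> X}"

definition block_comp ::
  "nat \<Rightarrow> nat \<Rightarrow> ((nat \<Rightarrow> real) \<Rightarrow> real) \<Rightarrow> ((nat \<Rightarrow> real) \<Rightarrow> real) \<Rightarrow> (nat \<times> nat \<Rightarrow> real) \<Rightarrow> real" where
  "block_comp n k F f z = F (\<lambda>i\<in>{..<k}. f (block n z i))"

end

theory Submission
  imports Defs
begin

text \<open>By duality, \<open>approx_deg\<close> exceeding \<open>d\<close> means that some \<open>\<psi>\<close> of unit \<open>\<ell>\<^sub>1\<close>-norm is orthogonal to all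
  polynomials of degree at most \<open>d\<close> and has correlation larger than the error with the function.
  Given such witnesses \<open>\<Psi>\<close> for \<open>F\<close> and \<open>\<psi>\<close> for \<open>f\<close>, the function
  \<open>2^k \<Psi>(sgn \<psi>(x\<^sub>1), \<dots>, sgn \<psi>(x\<^sub>k)) |\<psi>(x\<^sub>1)| \<dots> |\<psi>(x\<^sub>k)|\<close> is a witness for \<open>F(f, \<dots>, f)\<close>.
  Under the density \<open>|\<psi>|\<close> the sign of \<open>\<psi>\<close> is uniform, and conditioned on either sign it equals \<open>f\<close> with
  probability at least \<open>1 - \<delta>\<close>; agreement on a certificate of \<open>F\<close> is all that is needed, which costs
  \<open>2 - 2(1 - \<delta>)^C\<close> in the correlation. The gap \<open>\<eta>\<close> exists because the best approximation of \<open>F\<close> by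
  polynomials of bounded degree is attained.\<close>

subsection \<open>Duality for uniform approximation on a finite set\<close>

definition fun_subspace :: "('a \<Rightarrow> real) set \<Rightarrow> bool" where
  "fun_subspace L \<longleftrightarrow> (\<lambda>_. 0) \<in> L \<and> (\<forall>g\<in>L. \<forall>h\<in>L. \<forall>a. (\<lambda>x. g x + a * h x) \<in> L)"

lemma fun_subspace_zero: "fun_subspace L \<Longrightarrow> (\<lambda>_. 0) \<in> L"
  by (simp add: fun_subspace_def)

lemma fun_subspace_add_scaled:
  "fun_subspace L \<Longrightarrow> g \<in> L \<Longrightarrow> h \<in> L \<Longrightarrow> (\<lambda>x. g x + a * h x) \<in> L"
  by (simp add: fun_subspace_def)

lemma fun_subspace_scale: "fun_subspace L \<Longrightarrow> h \<in> L \<Longrightarrow> (\<lambda>x. a * h x) \<in> L"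
  using fun_subspace_add_scaled[OF _ fun_subspace_zero, of L h a] by simp

lemma fun_subspace_sum:
  assumes L: "fun_subspace L" and "\<And>i. i \<in> A \<Longrightarrow> g i \<in> L"
  shows "(\<lambda>x. \<Sum>i\<in>A. c i * g i x) \<in> L"
  using assms(2)
proof (induction A rule: infinite_finite_induct)
  case (insert i A)
  then show ?case
    using fun_subspace_add_scaled[OF L, of "\<lambda>x. \<Sum>i\<in>A. c i * g i x" "g i" "c i"]
    by (simp add: add.commute)
qed (use fun_subspace_zero[OF L] in auto)

lemma fun_subspace_closed:
  assumes "finite Z" "fun_subspace L" "\<And>n. u n \<in> L" "\<And>z. z \<in> Z \<Longrightarrow> (\<lambda>n. u n z) \<longlonglongrightarrow> g z"
  shows "\<exists>g'\<in>L. \<forall>z\<in>Z. g' z = g z"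
  using assms
proof (induction Z arbitrary: L u g rule: finite_induct)
  case empty
  then show ?case using fun_subspace_zero by blast
next
  case (insert z Z)
  note L = \<open>fun_subspace L\<close>
  show ?case
  proof (cases "\<forall>h\<in>L. h z = 0")
    case True
    have "u n z = 0" for n using insert.prems(2) True by blast
    then have "g z = 0" using insert.prems(3)[of z] by (simp add: LIMSEQ_const_iff)
    moreover have "\<exists>g'\<in>L. \<forall>z\<in>Z. g' z = g z"
      by (rule insert.IH[where g = g and u = u, OF insert.prems(1,2)]) (simp add: insert.prems(3))
    ultimately show ?thesis using True by auto
  next
    case False
    then obtain b0 where b0: "b0 \<in> L" "b0 z \<noteq> 0" by blast
    define b where "b = (\<lambda>x. inverse (b0 z) * b0 x)"
    have b: "b \<in> L" "b z = 1"
      unfolding b_def using fun_subspace_scale[OF L b0(1)] b0(2) by simp_all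
    define L' where "L' = {h \<in> L. h z = 0}"
    have L': "fun_subspace L'" using L by (auto simp: fun_subspace_def L'_def)
    define u' where "u' = (\<lambda>n x. u n x + (- u n z) * b x)"
    have u': "u' n \<in> L'" for n
      using fun_subspace_add_scaled[OF L insert.prems(2) b(1), of n "- u n z"] b(2)
      by (simp add: u'_def L'_def)
    have "(\<lambda>n. u' n x) \<longlonglongrightarrow> g x + (- g z) * b x" if "x \<in> Z" for x
      unfolding u'_def using that by (intro tendsto_intros insert.prems(3)) auto
    from insert.IH[where g = "\<lambda>x. g x + (- g z) * b x" and u = u', OF L' u' this]
    obtain g' where g': "g' \<in> L'" "\<forall>x\<in>Z. g' x = g x + (- g z) * b x" by blast
    have "(\<lambda>x. g' x + g z * b x) \<in> L"
      using fun_subspace_add_scaled[OF L _ b(1), of g'] g' by (simp add: L'_def)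
    moreover have "\<forall>x\<in>insert z Z. g' x + g z * b x = g x"
      using g' b(2) by (auto simp: L'_def)
    ultimately show ?thesis by (intro bexI[of _ "\<lambda>x. g' x + g z * b x"])
  qed
qed

lemma bounded_on_finite_convergent_subseq:
  fixes u :: "nat \<Rightarrow> 'a \<Rightarrow> real"
  assumes "finite Z" "\<And>z. z \<in> Z \<Longrightarrow> Bseq (\<lambda>n. u n z)"
  shows "\<exists>r. strict_mono r \<and> (\<forall>z\<in>Z. convergent (\<lambda>n. u (r n) z))"
  using assms
proof (induction Z rule: finite_induct)
  case empty
  show ?case by (rule exI[of _ id]) (auto simp: strict_mono_def)
next
  case (insert z Z)
  then obtain r where r: "strict_mono r" "\<forall>x\<in>Z. convergent (\<lambda>n. u (r n) x)" by auto
  obtain s where s: "strict_mono s" "monoseq (\<lambda>n. u (r (s n)) z)"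
    using seq_monosub[of "\<lambda>n. u (r n) z"] by auto
  have "Bseq (\<lambda>n. u (r (s n)) z)"
    using insert.prems[of z] by (auto simp: Bseq_def)
  then have "convergent (\<lambda>n. u (r (s n)) z)"
    using s(2) by (rule Bseq_monoseq_convergent)
  moreover have "convergent (\<lambda>n. u (r (s n)) x)" if "x \<in> Z" for x
    using convergent_subseq_convergent[OF r(2)[rule_format, OF that] s(1)] by (simp add: o_def)
  moreover have "strict_mono (r \<circ> s)" using r(1) s(1) by (rule strict_mono_o)
  ultimately show ?case by (intro exI[of _ "r \<circ> s"]) (simp add: o_def)
qed

lemma best_approximation_gap:
  assumes Z: "finite Z" and L: "fun_subspace L"
    and far: "\<And>p. p \<in> L \<Longrightarrow> \<exists>z\<in>Z. \<bar>h z - p z\<bar> > e"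
  shows "\<exists>E>e. \<forall>p\<in>L. \<exists>z\<in>Z. \<bar>h z - p z\<bar> \<ge> E"
proof (rule ccontr)
  assume neg: "\<not> ?thesis"
  have "\<exists>p\<in>L. \<forall>z\<in>Z. \<bar>h z - p z\<bar> < e + inverse (real (Suc n))" for n
    using neg by (metis less_add_same_cancel1 linorder_not_le of_nat_0_less_iff
        positive_imp_inverse_positive zero_less_Suc)
  then obtain u where u: "\<And>n. u n \<in> L"
      "\<And>n z. z \<in> Z \<Longrightarrow> \<bar>h z - u n z\<bar> < e + inverse (real (Suc n))"
    by metis
  have "Bseq (\<lambda>n. u n z)" if "z \<in> Z" for z
  proof (rule BseqI')
    fix n
    have "inverse (real (Suc n)) \<le> 1" by (simp add: field_simps)
    then show "norm (u n z) \<le> \<bar>h z\<bar> + e + 1" using u(2)[OF that, of n] by auto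
  qed
  then obtain r where r: "strict_mono r" "\<forall>z\<in>Z. convergent (\<lambda>n. u (r n) z)"
    using bounded_on_finite_convergent_subseq[OF Z, of u] by blast
  define g where "g z = lim (\<lambda>n. u (r n) z)" for z
  have g: "(\<lambda>n. u (r n) z) \<longlonglongrightarrow> g z" if "z \<in> Z" for z
    using r(2) that by (simp add: g_def convergent_LIMSEQ_iff)
  have "\<exists>p\<in>L. \<forall>z\<in>Z. p z = g z"
    by (rule fun_subspace_closed[OF Z L, of "\<lambda>n. u (r n)"]) (use u(1) g in auto)
  then obtain p where p: "p \<in> L" "\<forall>z\<in>Z. p z = g z" by blast
  have "\<bar>h z - p z\<bar> \<le> e" if "z \<in> Z" for z
  proof (rule LIMSEQ_le)
    show "(\<lambda>n. \<bar>h z - u (r n) z\<bar>) \<longlonglongrightarrow> \<bar>h z - p z\<bar>"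
      using g[OF that] p(2) that by (intro tendsto_intros) auto
    show "(\<lambda>n. e + inverse (real (Suc (r n)))) \<longlonglongrightarrow> e"
      using LIMSEQ_subseq_LIMSEQ[OF LIMSEQ_inverse_real_of_nat_add[of e] r(1)]
      by (simp add: o_def)
    show "\<exists>N. \<forall>n\<ge>N. \<bar>h z - u (r n) z\<bar> \<le> e + inverse (real (Suc (r n)))"
      using u(2)[OF that] by (meson less_imp_le)
  qed
  then show False using far[OF p(1)] by (meson linorder_not_le)
qed

text \<open>A linear functional on a space of functions on \<open>'a\<close> is represented by its graph, a space of
  functions on \<open>'a option\<close> whose value at \<open>None\<close> is the value of the functional.\<close>

lemma hahn_banach_step:
  assumes G: "fun_subspace G"
    and dom: "\<And>g. g \<in> G \<Longrightarrow> g None \<le> N (\<lambda>x. g (Some x))"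
    and sub: "\<And>g h. N (\<lambda>x. g x + h x) \<le> N g + N h"
    and hom: "\<And>a g. a > 0 \<Longrightarrow> N (\<lambda>x. a * g x) = a * N g"
  shows "\<exists>c. \<forall>g\<in>G. \<forall>t. g None + t * c \<le> N (\<lambda>x. g (Some x) + t * v x)"
proof -
  define S where "S = (\<lambda>g. g None - N (\<lambda>x. g (Some x) - v x)) ` G"
  have le: "g' None - N (\<lambda>x. g' (Some x) - v x) \<le> N (\<lambda>x. g (Some x) + v x) - g None"
    if "g \<in> G" "g' \<in> G" for g g'
  proof -
    have "g None + g' None \<le> N (\<lambda>x. g (Some x) + g' (Some x))"
      using dom[OF fun_subspace_add_scaled[OF G that, of 1]] by simp
    also have "\<dots> \<le> N (\<lambda>x. g (Some x) + v x) + N (\<lambda>x. g' (Some x) - v x)"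
      using sub[of "\<lambda>x. g (Some x) + v x" "\<lambda>x. g' (Some x) - v x"] by simp
    finally show ?thesis by simp
  qed
  have ne: "S \<noteq> {}" using fun_subspace_zero[OF G] by (auto simp: S_def)
  have bdd: "bdd_above S"
    using le[OF fun_subspace_zero[OF G]] by (auto simp: S_def bdd_above_def)
  define c where "c = Sup S"
  have lower: "g None - N (\<lambda>x. g (Some x) - v x) \<le> c" if "g \<in> G" for g
    unfolding c_def using that by (intro cSup_upper bdd) (auto simp: S_def)
  have upper: "c \<le> N (\<lambda>x. g (Some x) + v x) - g None" if "g \<in> G" for g
    unfolding c_def using le[OF that] by (intro cSup_least ne) (auto simp: S_def)
  have "g None + t * c \<le> N (\<lambda>x. g (Some x) + t * v x)" if g: "g \<in> G" for g t
  proof (cases t "0::real" rule: linorder_cases)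
    case equal
    then show ?thesis using dom[OF g] by simp
  next
    case greater
    have "(\<lambda>x. (1 / t) * g x) \<in> G" by (rule fun_subspace_scale[OF G g])
    from upper[OF this] have "t * c \<le> t * N (\<lambda>x. 1 / t * g (Some x) + v x) - g None"
      using greater by (simp add: field_simps)
    also have "t * N (\<lambda>x. 1 / t * g (Some x) + v x) = N (\<lambda>x. g (Some x) + t * v x)"
      using greater by (subst hom[symmetric]) (auto simp: algebra_simps)
    finally show ?thesis by simp
  next
    case less
    have "(\<lambda>x. (1 / - t) * g x) \<in> G" by (rule fun_subspace_scale[OF G g])
    from lower[OF this] have "g None - (- t) * N (\<lambda>x. 1 / - t * g (Some x) - v x) \<le> (- t) * c"
      using less by (simp add: field_simps)
    moreover have "(- t) * N (\<lambda>x. 1 / - t * g (Some x) - v x) = N (\<lambda>x. g (Some x) + t * v x)"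
      using less by (subst hom[symmetric]) (auto simp: algebra_simps)
    ultimately show ?thesis by simp
  qed
  then show ?thesis by blast
qed

lemma hahn_banach_finite:
  assumes "finite Z" and "fun_subspace G"
    and "\<And>g. g \<in> G \<Longrightarrow> g None \<le> N (\<lambda>x. g (Some x))"
    and sub: "\<And>g h. N (\<lambda>x. g x + h x) \<le> N g + N h"
    and hom: "\<And>a g. a > 0 \<Longrightarrow> N (\<lambda>x. a * g x) = a * N g"
  shows "\<exists>\<psi>. \<forall>g\<in>G. \<forall>t. g None + (\<Sum>z\<in>Z. t z * \<psi> z)
    \<le> N (\<lambda>x. g (Some x) + (if x \<in> Z then t x else 0))"
  using assms(1-3)
proof (induction Z arbitrary: G rule: finite_induct)
  case empty
  then show ?case by simp
next
  case (insert z Z)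
  note G = \<open>fun_subspace G\<close>
  define v where "v = (\<lambda>x. if x = z then 1 else 0 :: real)"
  obtain c where c: "\<And>g t. g \<in> G \<Longrightarrow> g None + t * c \<le> N (\<lambda>x. g (Some x) + t * v x)"
    using hahn_banach_step[where N = N, OF G insert.prems(2) sub hom, of v] by blast
  define w where "w = case_option c v"
  define G' where "G' = {\<lambda>y. g y + t * w y |g t. g \<in> G}"
  have "fun_subspace G'"
    unfolding fun_subspace_def
  proof (intro conjI ballI allI)
    show "(\<lambda>_. 0) \<in> G'"
      unfolding G'_def using fun_subspace_zero[OF G] by (auto intro!: exI[of _ "\<lambda>_. 0"] exI[of _ 0])
    fix g h a assume "g \<in> G'" "h \<in> G'"
    then obtain g1 t1 h1 s1 where *: "g1 \<in> G" "h1 \<in> G"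
      and eq: "g = (\<lambda>y. g1 y + t1 * w y)" "h = (\<lambda>y. h1 y + s1 * w y)"
      unfolding G'_def by auto
    have "(\<lambda>x. g x + a * h x) = (\<lambda>y. (g1 y + a * h1 y) + (t1 + a * s1) * w y)"
      by (auto simp: eq algebra_simps)
    then show "(\<lambda>x. g x + a * h x) \<in> G'"
      unfolding G'_def using fun_subspace_add_scaled[OF G *, of a]
      by (intro CollectI exI[of _ "\<lambda>x. g1 x + a * h1 x"] exI[of _ "t1 + a * s1"]) simp
  qed
  moreover have "g None \<le> N (\<lambda>x. g (Some x))" if "g \<in> G'" for g
    using that c by (auto simp: G'_def w_def)
  ultimately obtain \<psi> where \<psi>: "\<And>g t. g \<in> G' \<Longrightarrow> g None + (\<Sum>z\<in>Z. t z * \<psi> z)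
    \<le> N (\<lambda>x. g (Some x) + (if x \<in> Z then t x else 0))"
    using insert.IH[of G'] by blast
  have "g None + (\<Sum>y\<in>insert z Z. t y * (\<psi>(z := c)) y)
    \<le> N (\<lambda>x. g (Some x) + (if x \<in> insert z Z then t x else 0))" if "g \<in> G" for g t
  proof -
    have "(\<lambda>y. g y + t z * w y) \<in> G'" using that by (auto simp: G'_def)
    from \<psi>[OF this, of t]
    have "g None + t z * c + (\<Sum>y\<in>Z. t y * \<psi> y)
      \<le> N (\<lambda>x. g (Some x) + t z * v x + (if x \<in> Z then t x else 0))"
      by (simp add: w_def)
    moreover have "(\<lambda>x. g (Some x) + t z * v x + (if x \<in> Z then t x else 0)) =
        (\<lambda>x. g (Some x) + (if x \<in> insert z Z then t x else 0))"
      using insert.hyps by (auto simp: v_def)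
    moreover have "(\<Sum>y\<in>insert z Z. t y * (\<psi>(z := c)) y) = t z * c + (\<Sum>y\<in>Z. t y * \<psi> y)"
      using insert.hyps by (simp, intro sum.cong) auto
    ultimately show ?thesis by (simp add: add.assoc)
  qed
  then show ?case by blast
qed

lemma uniform_approximation_duality:
  assumes Z: "finite Z" and L: "fun_subspace L" and E: "E \<ge> 0"
    and far: "\<And>p. p \<in> L \<Longrightarrow> \<exists>z\<in>Z. \<bar>h z - p z\<bar> \<ge> E"
  shows "\<exists>\<psi>. (\<Sum>z\<in>Z. \<bar>\<psi> z\<bar>) \<le> 1 \<and> (\<Sum>z\<in>Z. \<psi> z * h z) \<ge> E \<and>
    (\<forall>p\<in>L. (\<Sum>z\<in>Z. \<psi> z * p z) = 0)"
proof -
  define N where "N g = Max (insert 0 ((\<lambda>z. \<bar>g z\<bar>) ` Z))" for g :: "'a \<Rightarrow> real"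
  have N_le: "N g \<le> B \<longleftrightarrow> 0 \<le> B \<and> (\<forall>z\<in>Z. \<bar>g z\<bar> \<le> B)" for g B
    unfolding N_def using Z by simp
  have N_ge: "0 \<le> N g" "z \<in> Z \<Longrightarrow> \<bar>g z\<bar> \<le> N g" for g z
    using N_le[of g "N g"] by auto
  have sub: "N (\<lambda>x. g x + h x) \<le> N g + N h" for g h
    unfolding N_le using N_ge(1)[of g] N_ge(1)[of h]
    by (auto intro!: order.trans[OF abs_triangle_ineq] add_mono N_ge(2))
  have hom: "N (\<lambda>x. a * g x) = a * N g" if "a > 0" for a g
  proof (rule antisym)
    show "N (\<lambda>x. a * g x) \<le> a * N g"
      unfolding N_le using that N_ge by (auto simp: abs_mult)
    have "N g \<le> N (\<lambda>x. a * g x) / a"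
      unfolding N_le using that N_ge(1) N_ge(2)[of _ "\<lambda>x. a * g x"]
      by (auto simp: abs_mult field_simps)
    then show "a * N g \<le> N (\<lambda>x. a * g x)" using that by (simp add: field_simps)
  qed
  define G where "G = {case_option (t * E) (\<lambda>x. p x + t * h x) |p t. p \<in> L}"
  have "fun_subspace G"
    unfolding fun_subspace_def
  proof (intro conjI ballI allI)
    show "(\<lambda>_. 0) \<in> G"
      unfolding G_def using fun_subspace_zero[OF L]
      by (auto intro!: exI[of _ "\<lambda>_. 0"] exI[of _ 0] simp: fun_eq_iff split: option.split)
    fix g g' a assume "g \<in> G" "g' \<in> G"
    then obtain p t p' t' where *: "p \<in> L" "p' \<in> L"
      and eq: "g = case_option (t * E) (\<lambda>x. p x + t * h x)"
        "g' = case_option (t' * E) (\<lambda>x. p' x + t' * h x)"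
      unfolding G_def by auto
    have "(\<lambda>x. g x + a * g' x) =
        case_option ((t + a * t') * E) (\<lambda>x. (p x + a * p' x) + (t + a * t') * h x)"
      by (auto simp: eq algebra_simps fun_eq_iff split: option.split)
    then show "(\<lambda>x. g x + a * g' x) \<in> G"
      unfolding G_def using fun_subspace_add_scaled[OF L *, of a]
      by (intro CollectI exI[of _ "\<lambda>x. p x + a * p' x"] exI[of _ "t + a * t'"]) simp
  qed
  moreover have "g None \<le> N (\<lambda>x. g (Some x))" if "g \<in> G" for g
  proof -
    obtain p t where p: "p \<in> L" and g: "g = case_option (t * E) (\<lambda>x. p x + t * h x)"
      using \<open>g \<in> G\<close> by (auto simp: G_def)
    show ?thesis
    proof (cases "t > 0")
      case True
      obtain z where z: "z \<in> Z" "\<bar>h z - (- 1 / t) * p z\<bar> \<ge> E"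
        using far[OF fun_subspace_scale[OF L p, of "- 1 / t"]] by blast
      have "t * E \<le> t * \<bar>h z - (- 1 / t) * p z\<bar>" using z(2) True by simp
      also have "\<dots> = \<bar>t * (h z - (- 1 / t) * p z)\<bar>" using True by (simp add: abs_mult)
      also have "t * (h z - (- 1 / t) * p z) = p z + t * h z" using True by (simp add: field_simps)
      also have "\<bar>\<dots>\<bar> \<le> N (\<lambda>x. g (Some x))" using N_ge(2)[OF z(1)] by (simp add: g)
      finally show ?thesis by (simp add: g)
    next
      case False
      then have "t * E \<le> 0" using E by (simp add: mult_nonpos_nonneg)
      then show ?thesis using N_ge(1) order.trans by (fastforce simp: g)
    qed
  qed
  ultimately obtain \<psi> where \<psi>: "\<And>g t. g \<in> G \<Longrightarrow> g None + (\<Sum>z\<in>Z. t z * \<psi> z)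
    \<le> N (\<lambda>x. g (Some x) + (if x \<in> Z then t x else 0))"
    using hahn_banach_finite[where N = N, OF Z _ _ sub hom, of G] by blast
  have bound: "t * E \<le> (\<Sum>z\<in>Z. \<psi> z * (p z + t * h z))" if "p \<in> L" for p t
  proof -
    have "case_option (t * E) (\<lambda>x. p x + t * h x) \<in> G" using that by (auto simp: G_def)
    from \<psi>[OF this, of "\<lambda>z. - (p z + t * h z)"]
    have "t * E + (\<Sum>z\<in>Z. - (p z + t * h z) * \<psi> z)
      \<le> N (\<lambda>x. p x + t * h x + (if x \<in> Z then - (p x + t * h x) else 0))" by simp
    also have "\<dots> \<le> 0" unfolding N_le by simp
    also have "(\<Sum>z\<in>Z. - (p z + t * h z) * \<psi> z) = - (\<Sum>z\<in>Z. \<psi> z * (p z + t * h z))"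
      unfolding sum_negf[symmetric] by (simp add: algebra_simps)
    finally show ?thesis by simp
  qed
  have "(\<lambda>_. 0) \<in> G" using \<open>fun_subspace G\<close> by (rule fun_subspace_zero)
  from \<psi>[OF this, of "\<lambda>z. sgn (\<psi> z)"]
  have "(\<Sum>z\<in>Z. \<bar>\<psi> z\<bar>) \<le> N (\<lambda>x. if x \<in> Z then sgn (\<psi> x) else 0)"
    by (simp add: abs_sgn mult.commute)
  also have "\<dots> \<le> 1" unfolding N_le by (simp add: abs_sgn_eq)
  finally have "(\<Sum>z\<in>Z. \<bar>\<psi> z\<bar>) \<le> 1" .
  moreover have "E \<le> (\<Sum>z\<in>Z. \<psi> z * h z)"
    using bound[OF fun_subspace_zero[OF L], of 1] by simp
  moreover have "(\<Sum>z\<in>Z. \<psi> z * p z) = 0" if "p \<in> L" for p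
    using bound[OF that, of 0] bound[OF fun_subspace_scale[OF L that, of "-1"], of 0]
    by (simp add: sum_negf)
  ultimately show ?thesis by blast
qed

lemma strict_dual_witness:
  assumes Z: "finite Z" and L: "fun_subspace L" and e: "e \<ge> 0"
    and far: "\<And>p. p \<in> L \<Longrightarrow> \<exists>z\<in>Z. \<bar>h z - p z\<bar> > e"
  obtains \<psi> where "(\<Sum>z\<in>Z. \<bar>\<psi> z\<bar>) = 1" "(\<Sum>z\<in>Z. \<psi> z * h z) > e"
    "\<And>p. p \<in> L \<Longrightarrow> (\<Sum>z\<in>Z. \<psi> z * p z) = 0"
proof -
  obtain E where E: "E > e" "\<And>p. p \<in> L \<Longrightarrow> \<exists>z\<in>Z. \<bar>h z - p z\<bar> \<ge> E"
    using best_approximation_gap[OF Z L far] by blast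
  obtain \<phi> where \<phi>: "(\<Sum>z\<in>Z. \<bar>\<phi> z\<bar>) \<le> 1" "(\<Sum>z\<in>Z. \<phi> z * h z) \<ge> E"
    "\<And>p. p \<in> L \<Longrightarrow> (\<Sum>z\<in>Z. \<phi> z * p z) = 0"
    using uniform_approximation_duality[OF Z L _ E(2)] e E(1) by force
  define c where "c = (\<Sum>z\<in>Z. \<bar>\<phi> z\<bar>)"
  have "c \<noteq> 0"
  proof
    assume "c = 0"
    then have "\<forall>z\<in>Z. \<phi> z = 0" using Z by (simp add: c_def sum_nonneg_eq_0_iff)
    then show False using \<phi>(2) E(1) e by simp
  qed
  moreover have "c \<ge> 0" by (simp add: c_def sum_nonneg)
  ultimately have c: "c > 0" "c \<le> 1" using \<phi>(1) by (simp_all flip: c_def)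
  show thesis
  proof
    show "(\<Sum>z\<in>Z. \<bar>\<phi> z / c\<bar>) = 1"
      using c by (simp add: sum_divide_distrib[symmetric]) (simp add: c_def)
    have "E \<le> E / c" using c E(1) e by (simp add: field_simps mult_left_le)
    also have "\<dots> \<le> (\<Sum>z\<in>Z. \<phi> z * h z) / c" using c \<phi>(2) by (intro divide_right_mono) auto
    finally show "(\<Sum>z\<in>Z. \<phi> z / c * h z) > e"
      using E(1) by (simp add: sum_divide_distrib)
    show "(\<Sum>z\<in>Z. \<phi> z / c * p z) = 0" if "p \<in> L" for p
      using \<phi>(3)[OF that] by (simp add: sum_divide_distrib[symmetric])
  qed
qed

subsection \<open>Polynomial functions\<close>

definition monom_eval :: "('v \<Rightarrow>\<^sub>0 nat) \<Rightarrow> ('v \<Rightarrow> real) \<Rightarrow> real" where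
  "monom_eval m z = (\<Prod>v\<in>Poly_Mapping.keys m. z v ^ Poly_Mapping.lookup m v)"

definition polyfun :: "'v set \<Rightarrow> nat \<Rightarrow> (('v \<Rightarrow> real) \<Rightarrow> real) set" where
  "polyfun I d = {rpoly_eval p |p. rpoly_vars p \<subseteq> I \<and> total_degree p \<le> d}"

lemma total_degree_le_iff:
  "total_degree p \<le> d \<longleftrightarrow>
    (\<forall>m\<in>Poly_Mapping.keys p. (\<Sum>v\<in>Poly_Mapping.keys m. Poly_Mapping.lookup m v) \<le> d)"
  unfolding total_degree_def by simp

lemma rpoly_eval_superset:
  assumes "finite A" "Poly_Mapping.keys p \<subseteq> A"
  shows "rpoly_eval p z = (\<Sum>m\<in>A. Poly_Mapping.lookup p m * monom_eval m z)"
  unfolding rpoly_eval_def monom_eval_def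
  using assms by (intro sum.mono_neutral_left) (auto simp: in_keys_iff)

lemma fun_subspace_polyfun:
  fixes I :: "'v set"
  shows "fun_subspace (polyfun I d)"
  unfolding fun_subspace_def
proof (intro conjI ballI allI)
  have "rpoly_eval (0 :: 'v rpoly) = (\<lambda>_. 0)" by (simp add: rpoly_eval_def fun_eq_iff)
  then show "(\<lambda>_. 0) \<in> polyfun I d"
    unfolding polyfun_def
    by (intro CollectI exI[of _ 0]) (simp add: rpoly_vars_def total_degree_le_iff)
  fix g h a assume "g \<in> polyfun I d" "h \<in> polyfun I d"
  then obtain p q where p: "rpoly_vars p \<subseteq> I" "total_degree p \<le> d"
    and q: "rpoly_vars q \<subseteq> I" "total_degree q \<le> d"
    and eq: "g = rpoly_eval p" "h = rpoly_eval q"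
    unfolding polyfun_def by auto
  define r where "r = p + Poly_Mapping.map ((*) a) q"
  have lookup_r: "Poly_Mapping.lookup r m = Poly_Mapping.lookup p m + a * Poly_Mapping.lookup q m" for m
    by (simp add: r_def lookup_add Poly_Mapping.map.rep_eq when_def)
  have keys_r: "Poly_Mapping.keys r \<subseteq> Poly_Mapping.keys p \<union> Poly_Mapping.keys q"
    by (auto simp: in_keys_iff lookup_r)
  have "(\<lambda>x. g x + a * h x) = rpoly_eval r"
  proof
    fix x
    let ?A = "Poly_Mapping.keys p \<union> Poly_Mapping.keys q"
    have "rpoly_eval r x = (\<Sum>m\<in>?A. Poly_Mapping.lookup r m * monom_eval m x)"
      using keys_r by (intro rpoly_eval_superset) auto
    also have "\<dots> = (\<Sum>m\<in>?A. Poly_Mapping.lookup p m * monom_eval m x)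
        + a * (\<Sum>m\<in>?A. Poly_Mapping.lookup q m * monom_eval m x)"
      by (simp add: lookup_r sum.distrib sum_distrib_left algebra_simps)
    also have "\<dots> = g x + a * h x"
      unfolding eq by (subst (1 2) rpoly_eval_superset[of ?A]) auto
    finally show "g x + a * h x = rpoly_eval r x" by simp
  qed
  moreover have "rpoly_vars r \<subseteq> I" using keys_r p(1) q(1) unfolding rpoly_vars_def by blast
  moreover have "total_degree r \<le> d"
    using keys_r p(2) q(2) unfolding total_degree_le_iff by blast
  ultimately show "(\<lambda>x. g x + a * h x) \<in> polyfun I d"
    unfolding polyfun_def by (intro CollectI exI[of _ r]) simp
qed

lemma monomial_in_polyfun:
  assumes I: "finite I" and d: "(\<Sum>v\<in>I. e v) \<le> d"
  shows "(\<lambda>z. \<Prod>v\<in>I. z v ^ e v) \<in> polyfun I d"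
proof -
  define m where "m = Abs_poly_mapping (\<lambda>v. if v \<in> I then e v else 0)"
  have lookup_m: "Poly_Mapping.lookup m = (\<lambda>v. if v \<in> I then e v else 0)"
    unfolding m_def using I by (intro lookup_Abs_poly_mapping) (auto intro: finite_subset)
  have keys_m: "Poly_Mapping.keys m = {v\<in>I. e v \<noteq> 0}"
    by (auto simp: in_keys_iff lookup_m split: if_splits)
  have "rpoly_eval (Poly_Mapping.single m 1) z = (\<Prod>v\<in>I. z v ^ e v)" for z
    unfolding rpoly_eval_def
    by (simp add: keys_m lookup_m, intro prod.mono_neutral_cong_left) (use I in auto)
  then have "rpoly_eval (Poly_Mapping.single m 1) = (\<lambda>z. \<Prod>v\<in>I. z v ^ e v)" by auto
  moreover have "(\<Sum>v\<in>Poly_Mapping.keys m. Poly_Mapping.lookup m v) \<le> (\<Sum>v\<in>I. e v)"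
    unfolding keys_m lookup_m using I by (intro sum_le_included[where i = id]) auto
  then have "total_degree (Poly_Mapping.single m (1::real)) \<le> d"
    using d by (simp add: total_degree_le_iff)
  moreover have "rpoly_vars (Poly_Mapping.single m (1::real)) \<subseteq> I"
    by (auto simp: rpoly_vars_def keys_m)
  ultimately show ?thesis
    unfolding polyfun_def by (intro CollectI exI[of _ "Poly_Mapping.single m 1"]) simp
qed

lemma approx_deg_le_polyfun:
  assumes "g \<in> polyfun I d" "\<And>z. z \<in> Z \<Longrightarrow> \<bar>h z - g z\<bar> \<le> e"
  shows "approx_deg I Z e h \<le> enat d"
proof -
  obtain p where p: "rpoly_vars p \<subseteq> I" "total_degree p \<le> d" "g = rpoly_eval p"
    using assms(1) by (auto simp: polyfun_def)
  have "approx_deg I Z e h \<le> enat (total_degree p)"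
    unfolding approx_deg_def using p assms(2) by (intro INF_lower) auto
  then show ?thesis using p(2) by (meson enat_ord_simps(1) order.trans)
qed

lemma prod_affine_in_polyfun:
  assumes I: "finite I" and T: "T \<subseteq> I" "card T \<le> d"
  shows "(\<lambda>z. \<Prod>i\<in>T. a i + b i * z i) \<in> polyfun I d"
proof -
  have fT: "finite T" using I T(1) by (rule rev_finite_subset)
  have "(\<lambda>z. \<Sum>U\<in>Pow T. ((\<Prod>i\<in>U. b i) * (\<Prod>i\<in>T - U. a i)) *
      (\<Prod>i\<in>I. z i ^ (if i \<in> U then 1 else 0))) \<in> polyfun I d"
  proof (intro fun_subspace_sum fun_subspace_polyfun monomial_in_polyfun I)
    fix U assume "U \<in> Pow T"
    then have U: "U \<subseteq> T" by simp
    have "(\<Sum>v\<in>I. if v \<in> U then 1 else 0) = card (I \<inter> U)"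
      using I by (simp add: sum.If_cases Int_def)
    also have "\<dots> \<le> card T" using U fT by (intro card_mono) auto
    finally show "(\<Sum>v\<in>I. if v \<in> U then 1 else 0) \<le> d" using T(2) by simp
  qed
  moreover have "(\<Prod>i\<in>T. a i + b i * z i) = (\<Sum>U\<in>Pow T. ((\<Prod>i\<in>U. b i) * (\<Prod>i\<in>T - U. a i)) *
      (\<Prod>i\<in>I. z i ^ (if i \<in> U then 1 else 0)))" for z
  proof -
    have "(\<Prod>i\<in>T. a i + b i * z i) = (\<Prod>i\<in>T. b i * z i + a i)" by (simp add: add.commute)
    also have "\<dots> = (\<Sum>U\<in>Pow T. (\<Prod>i\<in>U. b i * z i) * (\<Prod>i\<in>T - U. a i))"
      by (rule prod_add[OF fT])
    also have "\<dots> = (\<Sum>U\<in>Pow T. ((\<Prod>i\<in>U. b i) * (\<Prod>i\<in>T - U. a i)) *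
      (\<Prod>i\<in>I. z i ^ (if i \<in> U then 1 else 0)))"
    proof (rule sum.cong)
      fix U assume "U \<in> Pow T"
      then have "U \<subseteq> I" using T(1) by blast
      then have "(\<Prod>i\<in>I. z i ^ (if i \<in> U then 1 else 0)) = (\<Prod>i\<in>U. z i)"
        using I by (intro prod.mono_neutral_cong_right) auto
      then show "(\<Prod>i\<in>U. b i * z i) * (\<Prod>i\<in>T - U. a i) = ((\<Prod>i\<in>U. b i) * (\<Prod>i\<in>T - U. a i)) *
        (\<Prod>i\<in>I. z i ^ (if i \<in> U then 1 else 0))" by (simp add: prod.distrib)
    qed simp
    finally show ?thesis .
  qed
  ultimately show ?thesis by simp
qed

lemma finite_sign_cube: "finite (sign_cube k)"
  unfolding sign_cube_def by (intro finite_PiE) auto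

lemma approx_deg_sign_cube_le:
  assumes "e \<ge> 0"
  shows "approx_deg {..<k} (sign_cube k) e F \<le> enat k"
proof (rule approx_deg_le_polyfun)
  show "(\<lambda>z. \<Sum>x\<in>sign_cube k. F x * (\<Prod>i\<in>{..<k}. 1 / 2 + x i / 2 * z i)) \<in> polyfun {..<k} k"
    by (intro fun_subspace_sum fun_subspace_polyfun prod_affine_in_polyfun) auto
  fix z assume z: "z \<in> sign_cube k"
  have "(\<Prod>i\<in>{..<k}. 1 / 2 + x i / 2 * z i) = (if x = z then 1 else 0)" if x: "x \<in> sign_cube k" for x
  proof (cases "x = z")
    case True
    have "1 / 2 + x i / 2 * z i = 1" if "i < k" for i
    proof -
      have "z i = - 1 \<or> z i = 1" using z that by (auto simp: sign_cube_def PiE_iff)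
      then show ?thesis using True by auto
    qed
    then show ?thesis using True by simp
  next
    case False
    then obtain i where i: "x i \<noteq> z i" by blast
    then have ik: "i < k"
      using x z by (cases "i < k") (auto simp: sign_cube_def PiE_def extensional_def)
    have "x i \<in> {-1, 1}" "z i \<in> {-1, 1}" using x z ik by (auto simp: sign_cube_def)
    then have "1 / 2 + x i / 2 * z i = 0" using i by auto
    then show ?thesis using False ik by (simp, intro bexI[of _ i]) auto
  qed
  then have "(\<Sum>x\<in>sign_cube k. F x * (\<Prod>i\<in>{..<k}. 1 / 2 + x i / 2 * z i)) =
      (\<Sum>x\<in>sign_cube k. if x = z then F x else 0)"
    by (intro sum.cong) auto
  also have "\<dots> = F z" using z finite_sign_cube by simp
  finally show "\<bar>F z - (\<Sum>x\<in>sign_cube k. F x * (\<Prod>i\<in>{..<k}. 1 / 2 + x i / 2 * z i))\<bar> \<le> e"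
    using assms by simp
qed

lemma approx_deg_dual_witness:
  assumes "finite Z" "e \<ge> 0" "enat (Suc d) \<le> approx_deg I Z e h"
  obtains \<psi> where "(\<Sum>z\<in>Z. \<bar>\<psi> z\<bar>) = 1" "(\<Sum>z\<in>Z. \<psi> z * h z) > e"
    "\<And>p. p \<in> polyfun I d \<Longrightarrow> (\<Sum>z\<in>Z. \<psi> z * p z) = 0"
proof -
  have "\<exists>z\<in>Z. \<bar>h z - p z\<bar> > e" if p: "p \<in> polyfun I d" for p
  proof (rule ccontr)
    assume "\<not> ?thesis"
    then have "approx_deg I Z e h \<le> enat d"
      using approx_deg_le_polyfun[OF p] by (meson linorder_not_le)
    then have "enat (Suc d) \<le> enat d" using assms(3) order.trans by blast
    then show False by simp
  qed
  from strict_dual_witness[OF assms(1) fun_subspace_polyfun assms(2) this] show ?thesis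
    using that by blast
qed

lemma certificate_exists:
  assumes "z \<in> sign_cube k"
  obtains S where "S \<subseteq> {..<k}" "card S \<le> cert_complexity k F"
    "\<And>y. y \<in> sign_cube k \<Longrightarrow> \<forall>i\<in>S. y i = z i \<Longrightarrow> F y = F z"
proof -
  define \<S> where "\<S> = {S. S \<subseteq> {..<k} \<and> (\<forall>y\<in>sign_cube k. (\<forall>i\<in>S. y i = z i) \<longrightarrow> F z = F y)}"
  have "finite \<S>" by (rule finite_subset[of _ "Pow {..<k}"]) (auto simp: \<S>_def)
  moreover have "{..<k} \<in> \<S>"
  proof -
    have "y = z" if "y \<in> sign_cube k" "\<forall>i\<in>{..<k}. y i = z i" for y
      using that assms unfolding sign_cube_def by (intro PiE_ext) auto
    then show ?thesis by (auto simp: \<S>_def)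
  qed
  ultimately have "Min (card ` \<S>) \<in> card ` \<S>" by (intro Min_in) auto
  then obtain S where S: "S \<in> \<S>" "card S = cert_complexity_at k F z"
    by (auto simp: cert_complexity_at_def \<S>_def)
  have "card S \<le> cert_complexity k F"
    unfolding S(2) cert_complexity_def using assms finite_sign_cube by (intro Max_ge) auto
  then show ?thesis using S(1) that[of S] by (fastforce simp: \<S>_def)
qed

lemma sum_PiE_fibres:
  assumes "finite K" "finite X" "finite B" "\<And>x. x \<in> X \<Longrightarrow> s x \<in> B"
  shows "(\<Sum>x\<in>K \<rightarrow>\<^sub>E X. H x) = (\<Sum>z\<in>K \<rightarrow>\<^sub>E B. \<Sum>x\<in>PiE K (\<lambda>i. {y \<in> X. s y = z i}). H x)"
proof -
  have "(\<Sum>x\<in>K \<rightarrow>\<^sub>E X. H x) = (\<Sum>z\<in>K \<rightarrow>\<^sub>E B. \<Sum>x | x \<in> (K \<rightarrow>\<^sub>E X) \<and> (\<lambda>i\<in>K. s (x i)) = z. H x)"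
    using assms by (intro sum.group[symmetric] finite_PiE) (auto simp: PiE_iff)
  also have "\<dots> = (\<Sum>z\<in>K \<rightarrow>\<^sub>E B. \<Sum>x\<in>PiE K (\<lambda>i. {y \<in> X. s y = z i}). H x)"
  proof (rule sum.cong)
    fix z assume z: "z \<in> K \<rightarrow>\<^sub>E B"
    have "{x. x \<in> (K \<rightarrow>\<^sub>E X) \<and> (\<lambda>i\<in>K. s (x i)) = z} = PiE K (\<lambda>i. {y \<in> X. s y = z i})"
      using z by (auto simp: PiE_iff fun_eq_iff restrict_def extensional_def)
    then show "(\<Sum>x | x \<in> (K \<rightarrow>\<^sub>E X) \<and> (\<lambda>i\<in>K. s (x i)) = z. H x) =
        (\<Sum>x\<in>PiE K (\<lambda>i. {y \<in> X. s y = z i}). H x)" by simp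
  qed simp
  finally show ?thesis .
qed

lemma bij_betw_blocks:
  assumes "X \<subseteq> ({..<n} \<rightarrow>\<^sub>E UNIV)"
  shows "bij_betw (\<lambda>z. \<lambda>i\<in>{..<k}. block n z i) (set_power n k X) ({..<k} \<rightarrow>\<^sub>E X)"
proof (rule bij_betw_byWitness[where f' = "\<lambda>x. \<lambda>v\<in>{..<k} \<times> {..<n}. x (fst v) (snd v)"])
  have block: "block n (\<lambda>v\<in>{..<k} \<times> {..<n}. x (fst v) (snd v)) i = x i"
    if "x \<in> {..<k} \<rightarrow>\<^sub>E X" "i < k" for x i
  proof -
    have "x i \<in> {..<n} \<rightarrow>\<^sub>E UNIV" using that assms by auto
    then show ?thesis using that(2) by (auto simp: block_def fun_eq_iff PiE_iff extensional_def)
  qed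
  show "\<forall>z\<in>set_power n k X. (\<lambda>v\<in>{..<k} \<times> {..<n}. (\<lambda>i\<in>{..<k}. block n z i) (fst v) (snd v)) = z"
    by (auto simp: set_power_def block_def fun_eq_iff PiE_iff extensional_def)
  show "\<forall>x\<in>{..<k} \<rightarrow>\<^sub>E X. (\<lambda>i\<in>{..<k}. block n (\<lambda>v\<in>{..<k} \<times> {..<n}. x (fst v) (snd v)) i) = x"
    using block by (auto simp: fun_eq_iff PiE_iff extensional_def)
  show "(\<lambda>z. \<lambda>i\<in>{..<k}. block n z i) ` set_power n k X \<subseteq> {..<k} \<rightarrow>\<^sub>E X"
    by (auto simp: set_power_def)
  show "(\<lambda>x. \<lambda>v\<in>{..<k} \<times> {..<n}. x (fst v) (snd v)) ` ({..<k} \<rightarrow>\<^sub>E X) \<subseteq> set_power n k X"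
    using block by (auto simp: set_power_def PiE_iff)
qed

lemma monom_eval_blocks:
  assumes "Poly_Mapping.keys m \<subseteq> {..<k} \<times> {..<n}"
  shows "monom_eval m z = (\<Prod>i<k. \<Prod>j<n. block n z i j ^ Poly_Mapping.lookup m (i, j))"
proof -
  have "monom_eval m z = (\<Prod>v\<in>{..<k} \<times> {..<n}. z v ^ Poly_Mapping.lookup m v)"
    unfolding monom_eval_def using assms
    by (intro prod.mono_neutral_left) (auto simp: in_keys_iff)
  also have "\<dots> = (\<Prod>i<k. \<Prod>j<n. z (i, j) ^ Poly_Mapping.lookup m (i, j))"
    by (simp add: prod.cartesian_product case_prod_unfold)
  also have "\<dots> = (\<Prod>i<k. \<Prod>j<n. block n z i j ^ Poly_Mapping.lookup m (i, j))"
    by (intro prod.cong) (auto simp: block_def)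
  finally show ?thesis .
qed

subsection \<open>Composition of dual witnesses\<close>

locale dual_composition =
  fixes k :: nat and X :: "'a set" and \<psi> :: "'a \<Rightarrow> real" and \<Psi> :: "(nat \<Rightarrow> real) \<Rightarrow> real"
  assumes finite_X: "finite X"
    and norm_inner: "(\<Sum>y\<in>X. \<bar>\<psi> y\<bar>) = 1"
    and mean_inner: "(\<Sum>y\<in>X. \<psi> y) = 0"
    and norm_outer: "(\<Sum>z\<in>sign_cube k. \<bar>\<Psi> z\<bar>) = 1"
begin

definition sign_of :: "'a \<Rightarrow> real" where
  "sign_of y = (if \<psi> y \<ge> 0 then 1 else - 1)"

definition fibre :: "(nat \<Rightarrow> real) \<Rightarrow> (nat \<Rightarrow> 'a) set" where
  "fibre z = PiE {..<k} (\<lambda>i. {y \<in> X. sign_of y = z i})"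

definition weight :: "(nat \<Rightarrow> 'a) \<Rightarrow> real" where
  "weight x = (\<Prod>i<k. \<bar>\<psi> (x i)\<bar>)"

definition composed :: "(nat \<Rightarrow> 'a) \<Rightarrow> real" where
  "composed x = 2 ^ k * \<Psi> (\<lambda>i\<in>{..<k}. sign_of (x i)) * weight x"

lemma sum_over_fibres:
  "(\<Sum>x\<in>{..<k} \<rightarrow>\<^sub>E X. H x) = (\<Sum>z\<in>sign_cube k. \<Sum>x\<in>fibre z. H x)"
  unfolding sign_cube_def fibre_def
  using finite_X by (intro sum_PiE_fibres) (auto simp: sign_of_def)

lemma composed_on_fibre:
  assumes "z \<in> sign_cube k" "x \<in> fibre z"
  shows "composed x = 2 ^ k * \<Psi> z * weight x"
proof -
  have "(\<lambda>i\<in>{..<k}. sign_of (x i)) = z"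
    using assms by (auto simp: fibre_def sign_cube_def PiE_iff fun_eq_iff extensional_def)
  then show ?thesis by (simp add: composed_def)
qed

lemma sum_composed:
  "(\<Sum>x\<in>{..<k} \<rightarrow>\<^sub>E X. composed x * H x) =
    (\<Sum>z\<in>sign_cube k. \<Psi> z * (2 ^ k * (\<Sum>x\<in>fibre z. weight x * H x)))"
  unfolding sum_over_fibres sum_distrib_left
  by (intro sum.cong) (auto simp: composed_on_fibre)

lemma sum_fibre_prod:
  "(\<Sum>x\<in>fibre z. weight x * (\<Prod>i<k. g i (x i))) =
    (\<Prod>i<k. \<Sum>y | y \<in> X \<and> sign_of y = z i. \<bar>\<psi> y\<bar> * g i y)"
  unfolding fibre_def weight_def prod.distrib[symmetric]
  using finite_X by (intro prod_sum_PiE[symmetric]) auto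

lemma sum_by_sign:
  "(\<Sum>y\<in>X. g y) = (\<Sum>y | y \<in> X \<and> sign_of y = 1. g y) + (\<Sum>y | y \<in> X \<and> sign_of y = - 1. g y)"
proof -
  let ?P = "{y \<in> X. sign_of y = 1}" and ?N = "{y \<in> X. sign_of y = - 1}"
  have "(\<Sum>y\<in>X. g y) = (\<Sum>y\<in>?P \<union> ?N. g y)"
    by (rule sum.cong) (auto simp: sign_of_def)
  also have "\<dots> = (\<Sum>y\<in>?P. g y) + (\<Sum>y\<in>?N. g y)"
    using finite_X by (intro sum.union_disjoint) auto
  finally show ?thesis .
qed

lemma abs_eq_sign_mult: "\<bar>\<psi> y\<bar> = sign_of y * \<psi> y"
  by (simp add: sign_of_def)

lemma sum_sign_class:
  assumes "b \<in> {-1, 1}"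
  shows "(\<Sum>y | y \<in> X \<and> sign_of y = b. \<bar>\<psi> y\<bar> * g y) =
    (\<Sum>y\<in>X. \<bar>\<psi> y\<bar> * g y) / 2 + (\<Sum>y\<in>X. \<psi> y * g y) / 2 * b"
proof -
  define A where "A b = (\<Sum>y | y \<in> X \<and> sign_of y = b. \<bar>\<psi> y\<bar> * g y)" for b
  have "(\<Sum>y | y \<in> X \<and> sign_of y = c. \<psi> y * g y) = c * A c" if "c \<in> {-1, 1}" for c
    unfolding A_def sum_distrib_left using that
    by (intro sum.cong) (auto simp: abs_eq_sign_mult)
  then have "(\<Sum>y\<in>X. \<psi> y * g y) = A 1 - A (- 1)"
    using sum_by_sign[of "\<lambda>y. \<psi> y * g y"] by simp
  moreover have "(\<Sum>y\<in>X. \<bar>\<psi> y\<bar> * g y) = A 1 + A (- 1)"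
    unfolding A_def by (rule sum_by_sign)
  ultimately show ?thesis using assms unfolding A_def[symmetric] by (auto simp: field_simps)
qed

lemma sign_class_mass:
  "b \<in> {-1, 1} \<Longrightarrow> (\<Sum>y | y \<in> X \<and> sign_of y = b. \<bar>\<psi> y\<bar>) = 1 / 2"
  using sum_sign_class[of b "\<lambda>_. 1"] norm_inner mean_inner by simp

lemma sum_weight_fibre:
  assumes "z \<in> sign_cube k"
  shows "2 ^ k * (\<Sum>x\<in>fibre z. weight x) = 1"
proof -
  have "(\<Sum>x\<in>fibre z. weight x) = (\<Prod>i<k. \<Sum>y | y \<in> X \<and> sign_of y = z i. \<bar>\<psi> y\<bar>)"
    using sum_fibre_prod[of "\<lambda>_ _. 1" z] by simp
  also have "\<dots> = (\<Prod>i<k. 1 / 2)"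
    using assms by (intro prod.cong sign_class_mass) (auto simp: sign_cube_def PiE_iff)
  finally have "(\<Sum>x\<in>fibre z. weight x) = (\<Prod>i<k. 1 / 2)" .
  then show ?thesis by (simp add: power_one_over)
qed

lemma weight_nonneg: "weight x \<ge> 0"
  by (simp add: weight_def prod_nonneg)

lemma norm_composed: "(\<Sum>x\<in>{..<k} \<rightarrow>\<^sub>E X. \<bar>composed x\<bar>) = 1"
proof -
  have "(\<Sum>x\<in>{..<k} \<rightarrow>\<^sub>E X. \<bar>composed x\<bar>) =
      (\<Sum>z\<in>sign_cube k. \<bar>\<Psi> z\<bar> * (2 ^ k * (\<Sum>x\<in>fibre z. weight x)))"
    unfolding sum_over_fibres sum_distrib_left
    by (intro sum.cong) (auto simp: composed_on_fibre abs_mult weight_nonneg)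
  also have "\<dots> = 1" using norm_outer by (simp add: sum_weight_fibre)
  finally show ?thesis .
qed

text \<open>The sum over the sign class of \<open>z i\<close> is affine in \<open>z i\<close> with slope proportional to
  \<open>\<Sum>y\<in>X. \<psi> y * g i y\<close>, so only the factors not orthogonal to \<open>\<psi>\<close> contribute to the degree.\<close>

lemma composed_orthogonal_prod:
  assumes outer: "\<And>p. p \<in> polyfun {..<k} D \<Longrightarrow> (\<Sum>z\<in>sign_cube k. \<Psi> z * p z) = 0"
    and few: "card {i. i < k \<and> (\<Sum>y\<in>X. \<psi> y * g i y) \<noteq> 0} \<le> D"
  shows "(\<Sum>x\<in>{..<k} \<rightarrow>\<^sub>E X. composed x * (\<Prod>i<k. g i (x i))) = 0"
proof -
  define a b where "a i = (\<Sum>y\<in>X. \<bar>\<psi> y\<bar> * g i y) / 2" and "b i = (\<Sum>y\<in>X. \<psi> y * g i y) / 2" for i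
  define T where "T = {i. i < k \<and> b i \<noteq> 0}"
  define c where "c = 2 ^ k * (\<Prod>i\<in>{..<k} - T. a i)"
  have "(\<Sum>x\<in>{..<k} \<rightarrow>\<^sub>E X. composed x * (\<Prod>i<k. g i (x i))) =
      (\<Sum>z\<in>sign_cube k. \<Psi> z * (c * (\<Prod>i\<in>T. a i + b i * z i)))"
    unfolding sum_composed
  proof (rule sum.cong)
    fix z assume z: "z \<in> sign_cube k"
    have "(\<Sum>x\<in>fibre z. weight x * (\<Prod>i<k. g i (x i))) = (\<Prod>i<k. a i + b i * z i)"
      unfolding sum_fibre_prod a_def b_def
      using z by (intro prod.cong sum_sign_class) (auto simp: sign_cube_def PiE_iff)
    also have "\<dots> = (\<Prod>i\<in>{..<k} - T. a i + b i * z i) * (\<Prod>i\<in>T. a i + b i * z i)"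
      by (intro prod.subset_diff) (auto simp: T_def)
    also have "(\<Prod>i\<in>{..<k} - T. a i + b i * z i) = (\<Prod>i\<in>{..<k} - T. a i)"
      by (intro prod.cong) (auto simp: T_def)
    finally show "\<Psi> z * (2 ^ k * (\<Sum>x\<in>fibre z. weight x * (\<Prod>i<k. g i (x i)))) =
        \<Psi> z * (c * (\<Prod>i\<in>T. a i + b i * z i))" by (simp add: c_def)
  qed simp
  also have "\<dots> = 0"
  proof (rule outer, intro fun_subspace_scale fun_subspace_polyfun prod_affine_in_polyfun)
    show "card T \<le> D" using few by (simp add: T_def b_def)
  qed (auto simp: T_def)
  finally show ?thesis .
qed

lemma agreement_mass:
  assumes f: "f \<in> X \<rightarrow> {-1, 1}" and corr: "(\<Sum>y\<in>X. \<psi> y * f y) \<ge> 1 - \<delta>" and b: "b \<in> {-1, 1}"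
  shows "(\<Sum>y | y \<in> X \<and> sign_of y = b. \<bar>\<psi> y\<bar> * of_bool (f y = sign_of y)) \<ge> (1 - \<delta>) / 2"
proof -
  define err where "err Y = (\<Sum>y\<in>Y. \<bar>\<psi> y\<bar> * of_bool (f y \<noteq> sign_of y))" for Y
  have "(\<Sum>y\<in>X. \<psi> y * f y) = (\<Sum>y\<in>X. \<bar>\<psi> y\<bar> - 2 * (\<bar>\<psi> y\<bar> * of_bool (f y \<noteq> sign_of y)))"
  proof (rule sum.cong)
    fix y assume "y \<in> X"
    with f have "f y \<in> {-1, 1}" by (rule funcset_mem)
    then have "f y = 1 \<or> f y = - 1" by blast
    then show "\<psi> y * f y = \<bar>\<psi> y\<bar> - 2 * (\<bar>\<psi> y\<bar> * of_bool (f y \<noteq> sign_of y))"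
      by (elim disjE; cases "\<psi> y \<ge> 0") (simp_all add: sign_of_def)
  qed simp
  then have "(\<Sum>y\<in>X. \<psi> y * f y) = 1 - 2 * err X"
    by (simp add: sum_subtractf norm_inner err_def sum_distrib_left)
  then have "err X \<le> \<delta> / 2" using corr by simp
  moreover have "err {y \<in> X. sign_of y = b} \<le> err X"
    unfolding err_def using finite_X by (intro sum_mono2) auto
  moreover have "(\<Sum>y | y \<in> X \<and> sign_of y = b. \<bar>\<psi> y\<bar> * of_bool (f y = sign_of y)) =
      (\<Sum>y | y \<in> X \<and> sign_of y = b. \<bar>\<psi> y\<bar>) - err {y \<in> X. sign_of y = b}"
    unfolding err_def sum_subtractf[symmetric] by (intro sum.cong) auto
  ultimately show ?thesis using sign_class_mass[OF b] by (simp add: field_simps)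
qed

text \<open>Conditioned on the signs being \<open>z\<close>, the blocks are independent and each \<open>f (x i)\<close>
  equals \<open>z i\<close> with probability at least \<open>1 - \<delta>\<close>; agreement on a certificate for \<open>z\<close> suffices.\<close>

lemma fibre_correlation:
  assumes f: "f \<in> X \<rightarrow> {-1, 1}" and corr: "(\<Sum>y\<in>X. \<psi> y * f y) \<ge> 1 - \<delta>"
    and \<delta>: "0 < \<delta>" "\<delta> \<le> 1" and F: "F \<in> sign_cube k \<rightarrow> {-1, 1}" and z: "z \<in> sign_cube k"
  shows "\<bar>F z - 2 ^ k * (\<Sum>x\<in>fibre z. weight x * F (\<lambda>i\<in>{..<k}. f (x i)))\<bar>
    \<le> 2 - 2 * (1 - \<delta>) ^ cert_complexity k F"
proof -
  obtain S where S: "S \<subseteq> {..<k}" "card S \<le> cert_complexity k F"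
    "\<And>y. y \<in> sign_cube k \<Longrightarrow> \<forall>i\<in>S. y i = z i \<Longrightarrow> F y = F z"
    using certificate_exists[OF z] by blast
  define ok where "ok x = (\<Prod>i<k. if i \<in> S then of_bool (f (x i) = sign_of (x i)) else 1 :: real)"
    for x :: "nat \<Rightarrow> 'a"
  let ?f = "\<lambda>x. \<lambda>i\<in>{..<k}. f (x i)"
  have pw: "\<bar>F z - F (?f x)\<bar> \<le> 2 - 2 * ok x" if x: "x \<in> fibre z" for x
  proof -
    have fx: "?f x \<in> sign_cube k"
      using x f by (auto simp: fibre_def sign_cube_def PiE_iff)
    have two: "\<bar>F z - F (?f x)\<bar> \<le> 2"
    proof -
      have "F z \<in> {-1, 1}" "F (?f x) \<in> {-1, 1}"
        using funcset_mem[OF F] z fx by blast+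
      then show ?thesis by auto
    qed
    show ?thesis
    proof (cases "\<forall>i\<in>S. f (x i) = sign_of (x i)")
      case True
      have "(?f x) i = z i" if "i \<in> S" for i
        using that True x S(1) by (auto simp: fibre_def PiE_iff)
      then have "F (?f x) = F z" using S(3)[OF fx] by blast
      moreover have "ok x = 1" unfolding ok_def using True by (intro prod.neutral) auto
      ultimately show ?thesis by simp
    next
      case False
      then have "ok x = 0" unfolding ok_def using S(1) by (intro prod_zero) auto
      then show ?thesis using two by simp
    qed
  qed
  have mass: "2 ^ k * (\<Sum>x\<in>fibre z. weight x * c) = c" for c
    using sum_weight_fibre[OF z] by (simp add: sum_distrib_right[symmetric])
  have "(1 - \<delta>) ^ cert_complexity k F \<le> (1 - \<delta>) ^ card S"
    using S(2) \<delta> by (intro power_decreasing) auto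
  also have "\<dots> = 2 ^ k * (\<Prod>i<k. if i \<in> S then (1 - \<delta>) / 2 else 1 / 2)"
  proof -
    have "(\<Prod>i<k. if i \<in> S then (1 - \<delta>) / 2 else 1 / 2) = (\<Prod>i<k. (if i \<in> S then 1 - \<delta> else 1) * (1 / 2))"
      by (intro prod.cong) auto
    also have "\<dots> = (\<Prod>i<k. if i \<in> S then 1 - \<delta> else 1) * (1 / 2) ^ k"
      by (simp only: prod.distrib prod_constant card_lessThan)
    also have "(\<Prod>i<k. if i \<in> S then 1 - \<delta> else 1) = (\<Prod>i\<in>S. 1 - \<delta>)"
      using S(1) by (intro prod.mono_neutral_cong_right) auto
    finally show ?thesis by (simp add: power_one_over)
  qed
  also have "\<dots> \<le> 2 ^ k * (\<Sum>x\<in>fibre z. weight x * ok x)"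
    unfolding ok_def sum_fibre_prod[of "\<lambda>i y. if i \<in> S then of_bool (f y = sign_of y) else 1" z]
  proof (intro mult_left_mono prod_mono)
    fix i assume "i \<in> {..<k}"
    then have zi: "z i \<in> {-1, 1}" using z by (auto simp: sign_cube_def PiE_iff)
    show "0 \<le> (if i \<in> S then (1 - \<delta>) / 2 else 1 / 2) \<and> (if i \<in> S then (1 - \<delta>) / 2 else 1 / 2) \<le>
      (\<Sum>y | y \<in> X \<and> sign_of y = z i. \<bar>\<psi> y\<bar> * (if i \<in> S then of_bool (f y = sign_of y) else 1))"
      using \<delta> agreement_mass[OF f corr zi] sign_class_mass[OF zi] by simp
  qed simp
  finally have ok: "(1 - \<delta>) ^ cert_complexity k F \<le> 2 ^ k * (\<Sum>x\<in>fibre z. weight x * ok x)" .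
  have "F z - 2 ^ k * (\<Sum>x\<in>fibre z. weight x * F (?f x)) =
      2 ^ k * (\<Sum>x\<in>fibre z. weight x * (F z - F (?f x)))"
    using mass[of "F z"] by (simp add: sum_subtractf right_diff_distrib)
  also have "\<bar>\<dots>\<bar> \<le> 2 ^ k * (\<Sum>x\<in>fibre z. weight x * \<bar>F z - F (?f x)\<bar>)"
    unfolding abs_mult
    by (intro mult_mono order.trans[OF sum_abs] sum_mono) (auto simp: abs_mult weight_nonneg)
  also have "\<dots> \<le> 2 ^ k * (\<Sum>x\<in>fibre z. weight x * (2 - 2 * ok x))"
    using pw by (intro mult_left_mono sum_mono) (auto simp: weight_nonneg)
  also have "\<dots> = 2 - 2 * (2 ^ k * (\<Sum>x\<in>fibre z. weight x * ok x))"
    using mass[of 2] by (simp add: sum_subtractf right_diff_distrib sum_distrib_left mult_ac)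
  also have "\<dots> \<le> 2 - 2 * (1 - \<delta>) ^ cert_complexity k F" using ok by simp
  finally show ?thesis .
qed

lemma composed_correlation:
  assumes f: "f \<in> X \<rightarrow> {-1, 1}" and corr: "(\<Sum>y\<in>X. \<psi> y * f y) \<ge> 1 - \<delta>"
    and \<delta>: "0 < \<delta>" "\<delta> \<le> 1" and F: "F \<in> sign_cube k \<rightarrow> {-1, 1}"
  shows "(\<Sum>x\<in>{..<k} \<rightarrow>\<^sub>E X. composed x * F (\<lambda>i\<in>{..<k}. f (x i)))
    \<ge> (\<Sum>z\<in>sign_cube k. \<Psi> z * F z) - 2 + 2 * (1 - \<delta>) ^ cert_complexity k F"
proof -
  define M where "M z = 2 ^ k * (\<Sum>x\<in>fibre z. weight x * F (\<lambda>i\<in>{..<k}. f (x i)))" for z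
  let ?c = "2 - 2 * (1 - \<delta>) ^ cert_complexity k F"
  have "(\<Sum>z\<in>sign_cube k. \<Psi> z * F z) - (\<Sum>z\<in>sign_cube k. \<Psi> z * M z) =
      (\<Sum>z\<in>sign_cube k. \<Psi> z * (F z - M z))"
    by (simp add: sum_subtractf right_diff_distrib)
  also have "\<dots> \<le> (\<Sum>z\<in>sign_cube k. \<bar>\<Psi> z\<bar> * ?c)"
  proof (rule sum_mono)
    fix z assume z: "z \<in> sign_cube k"
    have "\<Psi> z * (F z - M z) \<le> \<bar>\<Psi> z\<bar> * \<bar>F z - M z\<bar>" by (metis abs_ge_self abs_mult)
    also have "\<dots> \<le> \<bar>\<Psi> z\<bar> * ?c"
      using fibre_correlation[OF assms z] unfolding M_def by (intro mult_left_mono) auto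
    finally show "\<Psi> z * (F z - M z) \<le> \<bar>\<Psi> z\<bar> * ?c" .
  qed
  also have "\<dots> = ?c" using norm_outer by (simp add: sum_distrib_right[symmetric])
  finally show ?thesis unfolding sum_composed M_def[symmetric] by simp
qed

end

lemma card_large_blocks:
  fixes e :: "nat \<Rightarrow> nat"
  assumes "(\<Sum>i<k. e i) < Suc D * d"
  shows "card {i. i < k \<and> d \<le> e i} \<le> D"
proof (rule ccontr)
  assume "\<not> ?thesis"
  then have "Suc D * d \<le> card {i. i < k \<and> d \<le> e i} * d" by (intro mult_right_mono) auto
  also have "\<dots> = (\<Sum>i | i < k \<and> d \<le> e i. d)" by simp
  also have "\<dots> \<le> (\<Sum>i | i < k \<and> d \<le> e i. e i)" by (intro sum_mono) auto
  also have "\<dots> \<le> (\<Sum>i<k. e i)" by (intro sum_mono2) auto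
  finally show False using assms by simp
qed

lemma composition_lower_bound:
  fixes X :: "(nat \<Rightarrow> real) set" and p :: "(nat \<times> nat) rpoly"
  assumes X: "finite X" "X \<subseteq> ({..<n} \<rightarrow>\<^sub>E UNIV)" and f: "f \<in> X \<rightarrow> {-1, 1}"
    and \<delta>: "0 < \<delta>" "\<delta> \<le> 1" and F: "F \<in> sign_cube k \<rightarrow> {-1, 1}"
    and norm_outer: "(\<Sum>z\<in>sign_cube k. \<bar>\<Psi> z\<bar>) = 1"
    and outer: "\<And>p. p \<in> polyfun {..<k} D \<Longrightarrow> (\<Sum>z\<in>sign_cube k. \<Psi> z * p z) = 0"
    and inner: "enat (Suc d) \<le> approx_deg {..<n} X (1 - \<delta>) f"
    and e: "e < (\<Sum>z\<in>sign_cube k. \<Psi> z * F z) - 2 + 2 * (1 - \<delta>) ^ cert_complexity k F"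
  shows "enat (Suc D * Suc d) \<le> approx_deg ({..<k} \<times> {..<n}) (set_power n k X) e (block_comp n k F f)"
  unfolding approx_deg_def
proof (rule INF_greatest, rule ccontr)
  fix p
  assume p: "p \<in> {p. rpoly_vars p \<subseteq> {..<k} \<times> {..<n} \<and>
    (\<forall>z\<in>set_power n k X. \<bar>block_comp n k F f z - rpoly_eval p z\<bar> \<le> e)}"
    and "\<not> enat (Suc D * Suc d) \<le> enat (total_degree p)"
  then have deg: "total_degree p < Suc D * Suc d" by (simp only: enat_ord_simps not_le)
  have nonneg: "0 \<le> 1 - \<delta>" using \<delta>(2) by simp
  obtain \<psi> where \<psi>: "(\<Sum>y\<in>X. \<bar>\<psi> y\<bar>) = 1" "(\<Sum>y\<in>X. \<psi> y * f y) > 1 - \<delta>"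
    "\<And>q. q \<in> polyfun {..<n} d \<Longrightarrow> (\<Sum>y\<in>X. \<psi> y * q y) = 0"
    using that by (rule approx_deg_dual_witness[OF X(1) nonneg inner])
  have "(\<Sum>y\<in>X. \<psi> y) = 0"
    using \<psi>(3)[OF monomial_in_polyfun[of "{..<n}" "\<lambda>_. 0"]] by simp
  then interpret dual_composition k X \<psi> \<Psi>
    using X(1) \<psi>(1) norm_outer by unfold_locales
  define bl where "bl z = (\<lambda>i\<in>{..<k}. block n z i)" for z
  have reindex: "(\<Sum>x\<in>{..<k} \<rightarrow>\<^sub>E X. H x) = (\<Sum>z\<in>set_power n k X. H (bl z))" for H :: "_ \<Rightarrow> real"
    unfolding bl_def by (rule sum.reindex_bij_betw[symmetric, OF bij_betw_blocks[OF X(2)]])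
  have monom: "(\<Sum>z\<in>set_power n k X. composed (bl z) * monom_eval m z) = 0"
    if m: "m \<in> Poly_Mapping.keys p" for m
  proof -
    have keys: "Poly_Mapping.keys m \<subseteq> {..<k} \<times> {..<n}" using p m by (auto simp: rpoly_vars_def)
    define g where "g i y = (\<Prod>j<n. y j ^ Poly_Mapping.lookup m (i, j))" for i and y :: "nat \<Rightarrow> real"
    define deg_in where "deg_in i = (\<Sum>j<n. Poly_Mapping.lookup m (i, j))" for i
    have "(\<Sum>i<k. deg_in i) = (\<Sum>v\<in>{..<k} \<times> {..<n}. Poly_Mapping.lookup m v)"
      by (simp add: deg_in_def sum.cartesian_product case_prod_unfold)
    also have "\<dots> = (\<Sum>v\<in>Poly_Mapping.keys m. Poly_Mapping.lookup m v)"
      using keys by (intro sum.mono_neutral_right) (auto simp: in_keys_iff)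
    also have "\<dots> < Suc D * Suc d"
      using deg m total_degree_le_iff[of p "total_degree p"] by (meson le_less_trans order.refl)
    finally have few: "card {i. i < k \<and> Suc d \<le> deg_in i} \<le> D" by (rule card_large_blocks)
    have "(\<Sum>y\<in>X. \<psi> y * g i y) = 0" if "\<not> Suc d \<le> deg_in i" for i
      unfolding g_def using that
      by (intro \<psi>(3) monomial_in_polyfun) (auto simp: deg_in_def)
    then have "card {i. i < k \<and> (\<Sum>y\<in>X. \<psi> y * g i y) \<noteq> 0} \<le> card {i. i < k \<and> Suc d \<le> deg_in i}"
      by (intro card_mono) auto
    then have "card {i. i < k \<and> (\<Sum>y\<in>X. \<psi> y * g i y) \<noteq> 0} \<le> D" using few by simp
    with outer have "(\<Sum>x\<in>{..<k} \<rightarrow>\<^sub>E X. composed x * (\<Prod>i<k. g i (x i))) = 0"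
      by (rule composed_orthogonal_prod)
    then show ?thesis
      unfolding reindex by (simp add: monom_eval_blocks[OF keys] g_def bl_def)
  qed
  have "(\<Sum>z\<in>set_power n k X. composed (bl z) * rpoly_eval p z) =
      (\<Sum>m\<in>Poly_Mapping.keys p. Poly_Mapping.lookup p m *
        (\<Sum>z\<in>set_power n k X. composed (bl z) * monom_eval m z))"
    unfolding rpoly_eval_superset[OF finite_keys order.refl] sum_distrib_left
    by (subst sum.swap) (simp add: mult_ac)
  then have orth: "(\<Sum>z\<in>set_power n k X. composed (bl z) * rpoly_eval p z) = 0"
    by (simp add: monom)
  have "(\<Sum>x\<in>{..<k} \<rightarrow>\<^sub>E X. composed x * F (\<lambda>i\<in>{..<k}. f (x i))) =
      (\<Sum>z\<in>set_power n k X. composed (bl z) * block_comp n k F f z)"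
    unfolding reindex block_comp_def
    by (intro sum.cong refl arg_cong2[where f = "(*)"] arg_cong[where f = F]) (auto simp: bl_def)
  also have "\<dots> = (\<Sum>z\<in>set_power n k X. composed (bl z) * (block_comp n k F f z - rpoly_eval p z))"
    using orth by (simp add: right_diff_distrib sum_subtractf)
  also have "\<dots> \<le> (\<Sum>z\<in>set_power n k X. \<bar>composed (bl z)\<bar> * e)"
  proof (rule sum_mono)
    fix z assume "z \<in> set_power n k X"
    then have "\<bar>block_comp n k F f z - rpoly_eval p z\<bar> \<le> e" using p by blast
    then have "\<bar>composed (bl z)\<bar> * \<bar>block_comp n k F f z - rpoly_eval p z\<bar> \<le> \<bar>composed (bl z)\<bar> * e"
      by (intro mult_left_mono) auto
    then show "composed (bl z) * (block_comp n k F f z - rpoly_eval p z) \<le> \<bar>composed (bl z)\<bar> * e"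
      by (metis abs_ge_self abs_mult order.trans)
  qed
  also have "\<dots> = e"
    using norm_composed by (simp add: sum_distrib_right[symmetric] reindex)
  finally show False
    using composed_correlation[OF f less_imp_le[OF \<psi>(2)] \<delta> F] e by linarith
qed

theorem theorem3p3:
  fixes k :: nat and F :: "(nat \<Rightarrow> real) \<Rightarrow> real" and \<epsilon> :: real
  assumes "F \<in> sign_cube k \<rightarrow> {-1, 1}" and "\<epsilon> > 0"
  shows "\<exists>\<eta>::real. \<eta> > 0 \<and>
    (\<forall>(n::nat) (X :: (nat \<Rightarrow> real) set) (f :: (nat \<Rightarrow> real) \<Rightarrow> real) (\<delta>::real).
       finite X \<longrightarrow> X \<subseteq> ({..<n} \<rightarrow>\<^sub>E UNIV) \<longrightarrow> f \<in> X \<rightarrow> {-1, 1} \<longrightarrow> 0 < \<delta> \<longrightarrow> \<delta> \<le> 1 \<longrightarrow>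
       approx_deg ({..<k} \<times> {..<n}) (set_power n k X)
           (\<epsilon> + \<eta> - 2 + 2 * (1 - \<delta>) ^ cert_complexity k F) (block_comp n k F f)
         \<ge> approx_deg {..<k} (sign_cube k) \<epsilon> F * approx_deg {..<n} X (1 - \<delta>) f)"
proof -
  obtain D where D: "approx_deg {..<k} (sign_cube k) \<epsilon> F = enat D"
    using approx_deg_sign_cube_le[of \<epsilon> k F] \<open>\<epsilon> > 0\<close>
    by (cases "approx_deg {..<k} (sign_cube k) \<epsilon> F") auto
  show ?thesis
  proof (cases D)
    case 0
    then show ?thesis by (intro exI[of _ 1]) (simp add: D zero_enat_def[symmetric])
  next
    case (Suc D')
    have outer: "enat (Suc D') \<le> approx_deg {..<k} (sign_cube k) \<epsilon> F" using D Suc by simp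
    obtain \<Psi> where \<Psi>: "(\<Sum>z\<in>sign_cube k. \<bar>\<Psi> z\<bar>) = 1" "(\<Sum>z\<in>sign_cube k. \<Psi> z * F z) > \<epsilon>"
      "\<And>p. p \<in> polyfun {..<k} D' \<Longrightarrow> (\<Sum>z\<in>sign_cube k. \<Psi> z * p z) = 0"
      using that by (rule approx_deg_dual_witness[OF finite_sign_cube less_imp_le[OF assms(2)] outer])
    define \<eta> where "\<eta> = ((\<Sum>z\<in>sign_cube k. \<Psi> z * F z) - \<epsilon>) / 2"
    have \<eta>: "\<eta> > 0" "\<epsilon> + \<eta> < (\<Sum>z\<in>sign_cube k. \<Psi> z * F z)"
      using \<Psi>(2) by (auto simp: \<eta>_def field_simps)
    have "enat D * approx_deg {..<n} X (1 - \<delta>) f \<le> approx_deg ({..<k} \<times> {..<n}) (set_power n k X)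
        (\<epsilon> + \<eta> - 2 + 2 * (1 - \<delta>) ^ cert_complexity k F) (block_comp n k F f)" (is "_ \<le> ?R")
      if X: "finite X" "X \<subseteq> ({..<n} \<rightarrow>\<^sub>E UNIV)" "f \<in> X \<rightarrow> {-1, 1}" "0 < \<delta>" "\<delta> \<le> 1"
      for n X f \<delta>
    proof -
      have bound: "enat (D * Suc d) \<le> ?R" if "enat (Suc d) \<le> approx_deg {..<n} X (1 - \<delta>) f" for d
        unfolding Suc using composition_lower_bound[OF X assms(1) \<Psi>(1,3) that] \<eta>(2) by simp
      show ?thesis
      proof (cases "approx_deg {..<n} X (1 - \<delta>) f")
        case (enat d)
        then show ?thesis using bound[of "d - 1"] by (cases d) (auto simp: zero_enat_def[symmetric])
      next
        case infinity
        have "enat d < ?R" for d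
        proof -
          have "enat d < enat (D * Suc d)" using Suc by simp
          also have "\<dots> \<le> ?R" using bound[of d] infinity by simp
          finally show ?thesis .
        qed
        then have "?R = \<infinity>" by (metis enat.exhaust less_irrefl)
        then show ?thesis by simp
      qed
    qed
    then show ?thesis using \<eta>(1) unfolding D by blast
  qed
qed

end
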